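(* Let $(G,X)$ be a $G$-system with $G$ a discrete infinite amenable group and $(X,d)$ a compact metric space, let $\mathcal{F}$ be a F{\o}lner net in $G$, and let $x\in X$. If $\mathcal{C}_{\mathcal{F}}(x)$ is not S-generic, then for every nonempty closed $G$-invariant subset $\Lambda\subseteq\mathcal{C}_{\mathcal{F}}(x)$ there is a point $y\in\Lambda$ such that the pair $\{x,y\}$ is Li-Yorke chaotic for $(G,X)$.
   Context: A $G$-system $(G,X)$: $G$ is a discrete infinite amenable group with identity $e$, $(X,d)$ is a compact metric space, and $G$ acts on $X$ from the left by continuous transformations ($ex=x$, $(gf)x=g(fx)$). A set $\Lambda\subseteq X$ is $G$-invariant if $g\Lambda\subseteq\Lambda$ for all $g\in G$. A (left) F{\o}lner net in $G$ is a net $\mathcal{F}=\{F_n\}_{n\in D}$ of (nonempty) finite subsets of $G$ with $\lim_{n\in D}|gF_n\vartriangle F_n|/|F_n|=0$ for all $g\in G$. For $A\subseteq G$, $\overline{d}_{\mathcal{F}}(A)=\sup\{\alpha \mid \forall m\in D\ \exists n\ge m:\ |A\cap F_n|/|F_n|\ge\alpha\}$ and $\underline{d}_{\mathcal{F}}(A)=\sup\{\alpha \mid \exists m\in D\ \forall n\ge m:\ |A\cap F_n|/|F_n|\ge\alpha\}$; if they coincide the common value is $d_{\mathcal{F}}(A)$. A closed set $C\subseteq X$ is an $\mathcal{F}$-center of attraction of $x$ if $d_{\mathcal{F}}(\{g\in G\mid gx\in B_\epsilon(C)\})=1$ for all $\epsilon>0$, where $B_\epsilon(C)$ is the $\epsilon$-neighborhood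 of $C$. The minimal one (no proper subset of which is an $\mathcal{F}$-center of attraction of $x$), which exists and is unique, is denoted $\mathcal{C}_{\mathcal{F}}(x)$. A $G$-invariant set $\Lambda\subseteq X$ is S-generic (relative to $\mathcal{F}$) if there is $y\in\Lambda$ with $\Lambda=\mathcal{C}_{\mathcal{F}}(y)$. A pair $\{x,y\}$ is proximal if there is a sequence $\{t_n\}_{n=1}^\infty$ in $G$ with $\lim_n d(t_nx,t_ny)=0$; it is asymptotic if for every $n\in\mathbb{N}$ there is a finite $F\subseteq G$ with $d(gx,gy)<1/n$ for all $g\in G\setminus F$; it is Li-Yorke chaotic if it is proximal but not asymptotic. *)

theory Defs
  imports "HOL-Analysis.Analysis" "HOL-Algebra.Coset"
begin

text \<open>Amenability of a discrete group in von Neumann's sense: there is a left-invariant finitely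
  additive probability measure on all subsets of the group.\<close>

definition amenable_group :: "('g, 'b) monoid_scheme \<Rightarrow> bool" where
  "amenable_group G \<longleftrightarrow> group G \<and>
     (\<exists>\<mu> :: 'g set \<Rightarrow> real.
        \<mu> (carrier G) = 1 \<and>
        (\<forall>A \<subseteq> carrier G. 0 \<le> \<mu> A) \<and>
        (\<forall>A \<subseteq> carrier G. \<forall>B \<subseteq> carrier G. A \<inter> B = {} \<longrightarrow> \<mu> (A \<union> B) = \<mu> A + \<mu> B) \<and>
        (\<forall>g \<in> carrier G. \<forall>A \<subseteq> carrier G. \<mu> (g <#\<^bsub>G\<^esub> A) = \<mu> A))"

text \<open>The phase space is a compact subset \<open>X\<close> of a metric type, with the restricted metric. The
  axioms of \<open>group_action\<close> in HOL-Algebra are not used because they also fix the values of the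
  action outside \<open>X\<close>.\<close>

locale G_system = group G
  for G :: "('g, 'b) monoid_scheme" (structure) +
  fixes X :: "'a::metric_space set"
    and act :: "'g \<Rightarrow> 'a \<Rightarrow> 'a"
  assumes infinite_carrier: "infinite (carrier G)"
    and amenable: "amenable_group G"
    and compact_space: "compact X"
    and act_closed: "g \<in> carrier G \<Longrightarrow> act g \<in> X \<rightarrow> X"
    and act_continuous: "g \<in> carrier G \<Longrightarrow> continuous_on X (act g)"
    and act_one: "x \<in> X \<Longrightarrow> act \<one> x = x"
    and act_mult: "\<lbrakk>g \<in> carrier G; f \<in> carrier G; x \<in> X\<rbrakk> \<Longrightarrow> act (g \<otimes> f) x = act g (act f x)"

definition G_invariant :: "('g, 'b) monoid_scheme \<Rightarrow> ('g \<Rightarrow> 'a \<Rightarrow> 'a) \<Rightarrow> 'a set \<Rightarrow> bool" where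
  "G_invariant G act \<Lambda> \<longleftrightarrow> (\<forall>g \<in> carrier G. act g ` \<Lambda> \<subseteq> \<Lambda>)"

text \<open>Nets are indexed by a set \<open>D\<close> directed by a preorder \<open>r\<close>, where \<open>(m, n) \<in> r\<close> stands for
  \<open>m \<le> n\<close>; \<open>tails D r\<close> is the filter of the tails of \<open>D\<close>.\<close>

definition directed_set :: "'d set \<Rightarrow> 'd rel \<Rightarrow> bool" where
  "directed_set D r \<longleftrightarrow> D \<noteq> {} \<and> preorder_on D r \<and>
     (\<forall>m \<in> D. \<forall>n \<in> D. \<exists>k \<in> D. (m, k) \<in> r \<and> (n, k) \<in> r)"

definition tails :: "'d set \<Rightarrow> 'd rel \<Rightarrow> 'd filter" where
  "tails D r = (INF m \<in> D. principal {n \<in> D. (m, n) \<in> r})"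

locale folner_net = group G
  for G :: "('g, 'b) monoid_scheme" (structure) +
  fixes D :: "'d set"
    and r :: "'d rel"
    and F :: "'d \<Rightarrow> 'g set"
  assumes directed: "directed_set D r"
    and F_subset: "n \<in> D \<Longrightarrow> F n \<subseteq> carrier G"
    and F_finite: "n \<in> D \<Longrightarrow> finite (F n)"
    and F_nonempty: "n \<in> D \<Longrightarrow> F n \<noteq> {}"
    and folner: "g \<in> carrier G \<Longrightarrow>
      ((\<lambda>n. real (card (sym_diff (g <# F n) (F n))) / real (card (F n)))
        \<longlongrightarrow> 0) (tails D r)"

definition upper_density :: "'d set \<Rightarrow> 'd rel \<Rightarrow> ('d \<Rightarrow> 'g set) \<Rightarrow> 'g set \<Rightarrow> real" where
  "upper_density D r F A =
     Sup {\<alpha>. \<forall>m \<in> D. \<exists>n \<in> D. (m, n) \<in> r \<and> real (card (A \<inter> F n)) / real (card (F n)) \<ge> \<alpha>}"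

definition lower_density :: "'d set \<Rightarrow> 'd rel \<Rightarrow> ('d \<Rightarrow> 'g set) \<Rightarrow> 'g set \<Rightarrow> real" where
  "lower_density D r F A =
     Sup {\<alpha>. \<exists>m \<in> D. \<forall>n \<in> D. (m, n) \<in> r \<longrightarrow> real (card (A \<inter> F n)) / real (card (F n)) \<ge> \<alpha>}"

definition has_density :: "'d set \<Rightarrow> 'd rel \<Rightarrow> ('d \<Rightarrow> 'g set) \<Rightarrow> 'g set \<Rightarrow> real \<Rightarrow> bool" where
  "has_density D r F A \<delta> \<longleftrightarrow> upper_density D r F A = \<delta> \<and> lower_density D r F A = \<delta>"

text \<open>The \<open>\<epsilon>\<close>-neighbourhood is a union of balls rather than \<open>{z. infdist z C < \<epsilon>}\<close> because
  \<open>infdist z {} = 0\<close>. It is taken in the ambient type, which makes no difference for points of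
  \<open>X\<close>.\<close>

definition center_of_attraction ::
  "('g, 'b) monoid_scheme \<Rightarrow> 'a::metric_space set \<Rightarrow> ('g \<Rightarrow> 'a \<Rightarrow> 'a) \<Rightarrow>
   'd set \<Rightarrow> 'd rel \<Rightarrow> ('d \<Rightarrow> 'g set) \<Rightarrow> 'a \<Rightarrow> 'a set \<Rightarrow> bool" where
  "center_of_attraction G X act D r F x C \<longleftrightarrow>
     closedin (top_of_set X) C \<and>
     (\<forall>\<epsilon>>0. has_density D r F {g \<in> carrier G. act g x \<in> (\<Union>c \<in> C. ball c \<epsilon>)} 1)"

text \<open>In a \<open>G\<close>-system with a Folner net every point of \<open>X\<close> has exactly one minimal center of
  attraction, so the description below is proper.\<close>

definition minimal_center ::
  "('g, 'b) monoid_scheme \<Rightarrow> 'a::metric_space set \<Rightarrow> ('g \<Rightarrow> 'a \<Rightarrow> 'a) \<Rightarrow>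
   'd set \<Rightarrow> 'd rel \<Rightarrow> ('d \<Rightarrow> 'g set) \<Rightarrow> 'a \<Rightarrow> 'a set" where
  "minimal_center G X act D r F x =
     (THE C. center_of_attraction G X act D r F x C \<and>
        (\<forall>C'. C' \<subset> C \<longrightarrow> \<not> center_of_attraction G X act D r F x C'))"

definition S_generic ::
  "('g, 'b) monoid_scheme \<Rightarrow> 'a::metric_space set \<Rightarrow> ('g \<Rightarrow> 'a \<Rightarrow> 'a) \<Rightarrow>
   'd set \<Rightarrow> 'd rel \<Rightarrow> ('d \<Rightarrow> 'g set) \<Rightarrow> 'a set \<Rightarrow> bool" where
  "S_generic G X act D r F \<Lambda> \<longleftrightarrow>
     \<Lambda> \<subseteq> X \<and> G_invariant G act \<Lambda> \<and> (\<exists>y \<in> \<Lambda>. \<Lambda> = minimal_center G X act D r F y)"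

definition proximal_pair ::
  "('g, 'b) monoid_scheme \<Rightarrow> ('g \<Rightarrow> 'a::metric_space \<Rightarrow> 'a) \<Rightarrow> 'a \<Rightarrow> 'a \<Rightarrow> bool" where
  "proximal_pair G act x y \<longleftrightarrow>
     (\<exists>t :: nat \<Rightarrow> 'g. range t \<subseteq> carrier G \<and> (\<lambda>n. dist (act (t n) x) (act (t n) y)) \<longlonglongrightarrow> 0)"

definition asymptotic_pair ::
  "('g, 'b) monoid_scheme \<Rightarrow> ('g \<Rightarrow> 'a::metric_space \<Rightarrow> 'a) \<Rightarrow> 'a \<Rightarrow> 'a \<Rightarrow> bool" where
  "asymptotic_pair G act x y \<longleftrightarrow>
     (\<forall>n::nat. n \<ge> 1 \<longrightarrow> (\<exists>K. finite K \<and> K \<subseteq> carrier G \<and>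
        (\<forall>g \<in> carrier G - K. dist (act g x) (act g y) < 1 / real n)))"

definition Li_Yorke_pair ::
  "('g, 'b) monoid_scheme \<Rightarrow> ('g \<Rightarrow> 'a::metric_space \<Rightarrow> 'a) \<Rightarrow> 'a \<Rightarrow> 'a \<Rightarrow> bool" where
  "Li_Yorke_pair G act x y \<longleftrightarrow> proximal_pair G act x y \<and> \<not> asymptotic_pair G act x y"

end

theory Submission
  imports Defs
begin

text \<open>Call a set of group elements null if its proportion in \<open>F n\<close> tends to \<open>0\<close>. The minimal center
  of attraction of \<open>x\<close> consists of the points none of whose balls is visited by the orbit of \<open>x\<close>
  along a null set only. The Folner condition makes null sets invariant under translation and, as
  \<open>G\<close> is infinite, makes finite sets null. So the center is invariant, and asymptotic points have
  the same center: if \<open>x\<close> were asymptotic to some \<open>y\<close> in its center, then \<open>y\<close> would witness that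
  this center is S-generic. Hence \<open>x\<close> is asymptotic to no point of \<open>\<Lambda>\<close>. A point of \<open>\<Lambda>\<close> proximal
  to \<open>x\<close> is \<open>u x\<close> for an idempotent \<open>u\<close> of the closed subsemigroup \<open>{p. p x \<in> \<Lambda>}\<close> of the
  enveloping semigroup, as in the theorem of Auslander and Ellis.\<close>

section \<open>Idempotents in compact semigroups of maps\<close>

text \<open>A product of Hausdorff spaces is Hausdorff, and compact subsets of a Hausdorff space are
  closed.\<close>

lemma compact_imp_closed_fun:
  fixes S :: "('a \<Rightarrow> 'b::t2_space) set"
  assumes "compact S"
  shows "closed S"
proof -
  have "Hausdorff_space (euclidean :: 'b topology)"
    by (simp add: Hausdorff_space_def disjnt_def) (metis hausdorff)
  then have "Hausdorff_space (product_topology (\<lambda>_::'a. euclidean :: 'b topology) UNIV)"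
    by (simp only: Hausdorff_space_product_topology) simp
  then have "Hausdorff_space (euclidean :: ('a \<Rightarrow> 'b) topology)"
    by (simp only: euclidean_product_topology)
  then show ?thesis
    using assms compactin_imp_closedin[of euclidean S] by simp
qed

lemma closed_coordinate_in:
  fixes A :: "'b::topological_space set"
  assumes "closed A"
  shows "closed {p :: 'a \<Rightarrow> 'b. p a \<in> A}"
proof -
  have "continuous_on UNIV (\<lambda>p :: 'a \<Rightarrow> 'b. p a)"
    by simp
  then show ?thesis
    using assms by (metis closed_vimage vimage_def)
qed

text \<open>The value of \<open>p \<circ> q\<close> at a point \<open>a\<close> is the coordinate of
  \<open>p\<close> at \<open>q a\<close>. Hence \<open>q\<close> may be any map, continuous or
  not.\<close>

lemma continuous_on_comp_right:
  "continuous_on S (\<lambda>p :: 'b \<Rightarrow> 'c::topological_space. p \<circ> q)"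
  unfolding comp_def
  by (intro continuous_on_coordinatewise_then_product)
    (simp add: continuous_on_subset[OF continuous_on_product_coordinates])

text \<open>The Ellis-Numakura lemma. Zorn gives a minimal closed subsemigroup \<open>M\<close>. For
  \<open>u\<close> in \<open>M\<close>, minimality forces \<open>M u = M\<close>, so
  \<open>p u = u\<close> has a solution in \<open>M\<close>. The solutions again form a closed
  subsemigroup, hence all of \<open>M\<close>, and \<open>u\<close> itself is one of them.\<close>

lemma idempotent_exists:
  fixes S :: "('a::t2_space \<Rightarrow> 'a) set"
  assumes compact: "compact S" and ne: "S \<noteq> {}"
    and comp: "\<And>p q. p \<in> S \<Longrightarrow> q \<in> S \<Longrightarrow> p \<circ> q \<in> S"
  shows "\<exists>u\<in>S. u \<circ> u = u"
proof -
  define \<A> where "\<A> = {A. A \<subseteq> S \<and> A \<noteq> {} \<and> closed A \<and> (\<forall>p\<in>A. \<forall>q\<in>A. p \<circ> q \<in> A)}"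
  have S: "S \<in> \<A>"
    using assms by (auto simp: \<A>_def compact_imp_closed_fun)
  have "\<exists>M\<in>\<A>. \<forall>A\<in>\<A>. A \<subseteq> M \<longrightarrow> A = M"
  proof (rule predicate_Zorn)
    \<comment> \<open>The order is reverse inclusion, so chains are bounded by their
      intersections.\<close>
    show "partial_order_on \<A> (relation_of (\<lambda>A B. B \<subseteq> A) \<A>)"
      by (rule partial_order_on_relation_ofI) auto
  next
    fix C assume C: "C \<in> Chains (relation_of (\<lambda>A B. B \<subseteq> A) \<A>)"
    then have CA: "C \<subseteq> \<A>" and chain: "\<And>A B. A \<in> C \<Longrightarrow> B \<in> C \<Longrightarrow> A \<subseteq> B \<or> B \<subseteq> A"
      by (auto simp: Chains_def relation_of_def)
    \<comment> \<open>A finite part of a chain has a smallest member. Adding \<open>S\<close>, which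
      contains every member, covers the empty part too.\<close>
    have min: "\<exists>B\<in>insert S C. B \<subseteq> S \<inter> \<Inter>C'" if "finite C'" "C' \<subseteq> C" for C'
      using that
    proof (induction C')
      case (insert A C')
      then obtain B where B: "B \<in> insert S C" "B \<subseteq> S \<inter> \<Inter>C'"
        by auto
      have "A \<subseteq> B \<or> B \<subseteq> A"
        using B(1) insert.prems chain CA by (auto simp: \<A>_def)
      then show ?case
      proof
        assume "A \<subseteq> B"
        moreover have "A \<in> insert S C"
          using insert.prems by auto
        ultimately show ?thesis
          using B(2) by (intro bexI[of _ A]) auto
      next
        assume "B \<subseteq> A"
        then show ?thesis
          using B by (intro bexI[of _ B]) auto
      qed
    qed auto
    have "S \<inter> \<Inter>C \<noteq> {}"
    proof (rule compact_imp_fip[OF compact])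
      show "closed T" if "T \<in> C" for T
        using that CA by (auto simp: \<A>_def)
      show "S \<inter> \<Inter>C' \<noteq> {}" if "finite C'" "C' \<subseteq> C" for C'
      proof -
        obtain B where "B \<in> insert S C" "B \<subseteq> S \<inter> \<Inter>C'"
          using min[OF \<open>finite C'\<close> \<open>C' \<subseteq> C\<close>] by blast
        moreover have "B \<noteq> {}"
          using \<open>B \<in> insert S C\<close> S CA by (auto simp: \<A>_def)
        ultimately show ?thesis
          by blast
      qed
    qed
    moreover have "closed (S \<inter> \<Inter>C)"
      using CA compact_imp_closed_fun[OF compact] by (auto simp: \<A>_def)
    ultimately have "S \<inter> \<Inter>C \<in> \<A>"
      using CA comp unfolding \<A>_def by blast
    then show "\<exists>U\<in>\<A>. \<forall>A\<in>C. U \<subseteq> A"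
      by (rule bexI[rotated]) auto
  qed
  then obtain M where M: "M \<in> \<A>" and minimal: "\<And>A. A \<in> \<A> \<Longrightarrow> A \<subseteq> M \<Longrightarrow> A = M"
    by blast
  from M have MS: "M \<subseteq> S" and "M \<noteq> {}" and clM: "closed M"
    and Mcomp: "\<And>p q. p \<in> M \<Longrightarrow> q \<in> M \<Longrightarrow> p \<circ> q \<in> M"
    by (auto simp: \<A>_def)
  then obtain u where u: "u \<in> M"
    by blast
  have cM: "compact M"
    using compact_Int_closed[OF compact clM] MS by (simp add: Int_absorb1)
  have "(\<lambda>p. p \<circ> u) ` M = M"
  proof (rule minimal)
    have "compact ((\<lambda>p. p \<circ> u) ` M)"
      by (rule compact_continuous_image[OF continuous_on_comp_right cM])
    then have "closed ((\<lambda>p. p \<circ> u) ` M)"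
      by (rule compact_imp_closed_fun)
    moreover have "(p \<circ> u) \<circ> (q \<circ> u) \<in> (\<lambda>p. p \<circ> u) ` M" if "p \<in> M" "q \<in> M" for p q
    proof -
      \<comment> \<open>Regroup \<open>(p u)(q u)\<close> as \<open>((p u) q) u\<close>.\<close>
      have "(p \<circ> u) \<circ> q \<in> M"
        using that u Mcomp by blast
      then show ?thesis
        by (metis (no_types, lifting) comp_assoc image_iff)
    qed
    ultimately show "(\<lambda>p. p \<circ> u) ` M \<in> \<A>"
      using u Mcomp MS by (auto simp: \<A>_def)
    show "(\<lambda>p. p \<circ> u) ` M \<subseteq> M"
      using u Mcomp by auto
  qed
  then obtain p where p: "p \<in> M" "p \<circ> u = u"
    using u by (metis (mono_tags, lifting) imageE)
  have "{p \<in> M. p \<circ> u = u} = M"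
  proof (rule minimal)
    \<comment> \<open>The equation is a family of conditions on single coordinates of
      \<open>p\<close>, namely those at the points \<open>u a\<close>; each is closed.\<close>
    have "{p \<in> M. p \<circ> u = u} = M \<inter> (\<Inter>a. {p. p (u a) \<in> {u a}})"
      by (auto simp: fun_eq_iff)
    also have "closed \<dots>"
      by (intro closed_Int clM closed_INT ballI closed_coordinate_in closed_singleton)
    finally have "closed {p \<in> M. p \<circ> u = u}" .
    moreover have "p \<circ> q \<circ> u = u" if "p \<circ> u = u" "q \<circ> u = u" for p q
      using that by (simp add: comp_assoc)
    ultimately show "{p \<in> M. p \<circ> u = u} \<in> \<A>"
      using p Mcomp MS by (auto simp: \<A>_def)
  qed auto
  then show ?thesis
    using u MS by blast
qed

section \<open>Proximal points in invariant sets\<close>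

lemma proximal_pairI:
  assumes "\<And>\<epsilon>. \<epsilon> > 0 \<Longrightarrow> \<exists>g\<in>carrier G. dist (act g x) (act g y) < \<epsilon>"
  shows "proximal_pair G act x y"
proof -
  obtain t where t: "\<And>n. t n \<in> carrier G \<and> dist (act (t n) x) (act (t n) y) < inverse (real (Suc n))"
    using assms[of "inverse (real (Suc n))" for n] by (metis inverse_positive_iff_positive of_nat_0_less_iff zero_less_Suc)
  have "(\<lambda>n. dist (act (t n) x) (act (t n) y)) \<longlonglongrightarrow> 0"
    by (rule tendsto_sandwich[OF _ _ tendsto_const LIMSEQ_inverse_real_of_nat])
      (use t in \<open>auto intro!: always_eventually less_imp_le\<close>)
  then show ?thesis
    unfolding proximal_pair_def using t by blast
qed

section \<open>The enveloping semigroup and the Auslander-Ellis argument\<close>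

context G_system
begin

text \<open>Maps are extended by the identity outside \<open>X\<close>, so that the enveloping semigroup lives in the
  product topology of the function type.\<close>

definition ext_act :: "'g \<Rightarrow> 'a \<Rightarrow> 'a" where
  "ext_act g z = (if z \<in> X then act g z else z)"

definition enveloping_semigroup :: "('a \<Rightarrow> 'a) set" where
  "enveloping_semigroup = closure (ext_act ` carrier G)"

text \<open>A box with compact factors, \<open>X\<close> or a singleton, hence compact by Tychonoff.
  It serves as the compact ambient set for the closure of the group.\<close>

definition self_maps :: "('a \<Rightarrow> 'a) set" where
  "self_maps = (\<Pi>\<^sub>E z\<in>UNIV. if z \<in> X then X else {z})"

lemma self_maps_in: "p \<in> self_maps \<Longrightarrow> z \<in> X \<Longrightarrow> p z \<in> X"
  and self_maps_out: "p \<in> self_maps \<Longrightarrow> z \<notin> X \<Longrightarrow> p z = z"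
  by (auto simp: self_maps_def PiE_iff dest: spec[of _ z])

lemma act_in: "g \<in> carrier G \<Longrightarrow> z \<in> X \<Longrightarrow> act g z \<in> X"
  using act_closed by blast

lemma compact_self_maps: "compact self_maps"
proof -
  have "compactin (product_topology (\<lambda>_. euclidean) UNIV) self_maps"
    unfolding self_maps_def compactin_PiE using compact_space by auto
  then show ?thesis
    by (simp add: euclidean_product_topology)
qed

lemma ext_act_self_maps: "ext_act ` carrier G \<subseteq> self_maps"
  using act_in by (auto simp: ext_act_def self_maps_def)

lemma enveloping_subset: "enveloping_semigroup \<subseteq> self_maps"
  unfolding enveloping_semigroup_def
  by (rule closure_minimal[OF ext_act_self_maps compact_imp_closed_fun[OF compact_self_maps]])

lemma compact_enveloping: "compact enveloping_semigroup"
  using compact_Int_closed[OF compact_self_maps, of enveloping_semigroup] enveloping_subset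
  by (simp add: enveloping_semigroup_def Int_absorb1)

lemma ext_act_mult:
  "g \<in> carrier G \<Longrightarrow> h \<in> carrier G \<Longrightarrow> ext_act g \<circ> ext_act h = ext_act (g \<otimes> h)"
  using act_in act_mult by (auto simp: ext_act_def fun_eq_iff)

text \<open>Composition is not jointly continuous, so the closure is taken one factor at a time:
  first in \<open>q\<close> with a group element on the left, then in \<open>p\<close> with an
  arbitrary \<open>q\<close> of the semigroup on the right.\<close>

lemma enveloping_comp:
  assumes "p \<in> enveloping_semigroup" "q \<in> enveloping_semigroup"
  shows "p \<circ> q \<in> enveloping_semigroup"
proof -
  have left: "ext_act g \<circ> q \<in> enveloping_semigroup"
    if g: "g \<in> carrier G" and q: "q \<in> enveloping_semigroup" for g q
  proof -
    have "continuous_on enveloping_semigroup (\<lambda>q. ext_act g \<circ> q)"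
      unfolding comp_def
    proof (rule continuous_on_coordinatewise_then_product)
      fix z
      have ev: "continuous_on enveloping_semigroup (\<lambda>q. q z)"
        by (rule continuous_on_subset[OF continuous_on_product_coordinates]) auto
      show "continuous_on enveloping_semigroup (\<lambda>q. ext_act g (q z))"
      \<comment> \<open>\<open>ext_act g\<close> may be discontinuous at the boundary of
        \<open>X\<close>, but each coordinate \<open>q z\<close> either stays in \<open>X\<close> or
        is constantly \<open>z\<close>.\<close>
      proof (cases "z \<in> X")
        case True
        have "continuous_on enveloping_semigroup (\<lambda>q. act g (q z))"
          by (rule continuous_on_compose2[OF act_continuous[OF g] ev])
            (use True enveloping_subset self_maps_in in blast)
        moreover have "ext_act g (q z) = act g (q z)" if "q \<in> enveloping_semigroup" for q
          using that True enveloping_subset self_maps_in by (auto simp: ext_act_def)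
        ultimately show ?thesis
          by (simp cong: continuous_on_cong)
      next
        case False
        have "ext_act g (q z) = z" if "q \<in> enveloping_semigroup" for q
        proof -
          have "q z = z"
            using that False enveloping_subset self_maps_out by blast
          then show ?thesis
            using False by (simp add: ext_act_def)
        qed
        then show ?thesis
          by (simp cong: continuous_on_cong)
      qed
    qed
    moreover have "(\<lambda>q. ext_act g \<circ> q) ` ext_act ` carrier G \<subseteq> enveloping_semigroup"
      using g closure_subset by (force simp: ext_act_mult enveloping_semigroup_def)
    ultimately have "(\<lambda>q. ext_act g \<circ> q) ` enveloping_semigroup \<subseteq> enveloping_semigroup"
      unfolding enveloping_semigroup_def by (intro image_closure_subset) auto
    then show ?thesis
      using q by blast
  qed
  have "(\<lambda>p. p \<circ> q) ` closure (ext_act ` carrier G) \<subseteq> enveloping_semigroup"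
    by (rule image_closure_subset[OF continuous_on_comp_right])
      (use left assms(2) in \<open>auto simp: enveloping_semigroup_def\<close>)
  then show ?thesis
    using assms(1) by (auto simp: enveloping_semigroup_def)
qed

text \<open>Closeness at two coordinates is an open condition for pointwise convergence, so one
  group element achieves it at both points.\<close>

lemma enveloping_approx:
  assumes "u \<in> enveloping_semigroup" "\<epsilon> > 0"
  shows "\<exists>g\<in>carrier G. dist (ext_act g x) (u x) < \<epsilon> \<and> dist (ext_act g y) (u y) < \<epsilon>"
proof -
  let ?U = "{p :: 'a \<Rightarrow> 'a. p x \<in> ball (u x) \<epsilon>} \<inter> {p. p y \<in> ball (u y) \<epsilon>}"
  have "open {p :: 'a \<Rightarrow> 'a. p z \<in> ball (u z) \<epsilon>}" for z
    using closed_coordinate_in[of "- ball (u z) \<epsilon>" z] by (simp add: closed_def Collect_neg_eq[symmetric])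
  then have "open ?U"
    by auto
  moreover have "u \<in> ?U"
    using assms(2) by simp
  ultimately obtain p where "p \<in> ext_act ` carrier G" "p \<in> ?U"
    using assms(1) open_Int_closure_eq_empty[of ?U "ext_act ` carrier G"]
    unfolding enveloping_semigroup_def by blast
  then show ?thesis
    by (auto simp: dist_commute)
qed

text \<open>An idempotent \<open>u\<close> takes the same value at \<open>x\<close> and at
  \<open>u x\<close>. Group elements that approximate \<open>u\<close> at both points therefore
  bring these points together.\<close>

theorem proximal_point_exists:
  assumes x: "x \<in> X" and \<Lambda>: "\<Lambda> \<noteq> {}" "closed \<Lambda>" "\<Lambda> \<subseteq> X" "G_invariant G act \<Lambda>"
    and orbit: "\<Lambda> \<subseteq> closure ((\<lambda>g. act g x) ` carrier G)"
  shows "\<exists>y\<in>\<Lambda>. proximal_pair G act x y"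
proof -
  define S where "S = enveloping_semigroup \<inter> {p. p x \<in> \<Lambda>}"
  \<comment> \<open>Evaluation at \<open>x\<close> sends the compact semigroup to a closed set
    containing the orbit, so every point of \<Lambda> has the form \<open>p x\<close>.\<close>
  have "closure ((\<lambda>g. act g x) ` carrier G) \<subseteq> (\<lambda>p. p x) ` enveloping_semigroup"
  proof (rule closure_minimal)
    show "(\<lambda>g. act g x) ` carrier G \<subseteq> (\<lambda>p. p x) ` enveloping_semigroup"
    proof
      fix z assume "z \<in> (\<lambda>g. act g x) ` carrier G"
      then obtain g where "g \<in> carrier G" "z = ext_act g x"
        using x by (auto simp: ext_act_def)
      then show "z \<in> (\<lambda>p. p x) ` enveloping_semigroup"
        unfolding enveloping_semigroup_def
        using closure_subset[of "ext_act ` carrier G"] by (intro image_eqI[of _ _ "ext_act g"]) auto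
    qed
    have "continuous_on enveloping_semigroup (\<lambda>p. p x)"
      by (rule continuous_on_subset[OF continuous_on_product_coordinates]) auto
    then show "closed ((\<lambda>p. p x) ` enveloping_semigroup)"
      by (intro compact_imp_closed compact_continuous_image compact_enveloping)
  qed
  then have "S \<noteq> {}"
    using \<Lambda>(1) orbit unfolding S_def by blast
  moreover have "compact S"
    unfolding S_def by (intro compact_Int_closed compact_enveloping closed_coordinate_in \<Lambda>)
  moreover have "p \<circ> q \<in> S" if "p \<in> S" "q \<in> S" for p q
  proof -
    \<comment> \<open>Group elements preserve \<Lambda>, and this passes to pointwise limits because
      \<Lambda> is closed. Thus \<open>p (q x)\<close> lies in \<Lambda> as soon as
      \<open>q x\<close> does.\<close>
    have "enveloping_semigroup \<subseteq> {p. p z \<in> \<Lambda>}" if "z \<in> \<Lambda>" for z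
      unfolding enveloping_semigroup_def
    proof (rule closure_minimal)
      show "ext_act ` carrier G \<subseteq> {p. p z \<in> \<Lambda>}"
        using \<Lambda>(4) that by (auto simp: ext_act_def G_invariant_def image_subset_iff)
    qed (intro closed_coordinate_in \<Lambda>)
    then show ?thesis
      using that enveloping_comp unfolding S_def by auto
  qed
  ultimately obtain u where u: "u \<in> S" and uu: "u \<circ> u = u"
    using idempotent_exists[of S] by blast
  have uL: "u x \<in> \<Lambda>" and uE: "u \<in> enveloping_semigroup"
    using u by (auto simp: S_def)
  have "proximal_pair G act x (u x)"
  proof (rule proximal_pairI)
    fix \<epsilon> :: real assume "\<epsilon> > 0"
    then obtain g where g: "g \<in> carrier G" "dist (ext_act g x) (u x) < \<epsilon>/2"
      "dist (ext_act g (u x)) (u (u x)) < \<epsilon>/2"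
      using enveloping_approx[OF uE, of "\<epsilon>/2" x "u x"] by auto
    have "u (u x) = u x"
      using uu by (metis comp_apply)
    then have "dist (act g x) (act g (u x)) < \<epsilon>"
      using g x uL \<Lambda>(3) dist_triangle_half_l[of "ext_act g x" "u x" \<epsilon> "ext_act g (u x)"]
      by (auto simp: ext_act_def)
    then show "\<exists>g\<in>carrier G. dist (act g x) (act g (u x)) < \<epsilon>"
      using g by blast
  qed
  then show ?thesis
    using uL by blast
qed

end

section \<open>Null sets of a Folner net\<close>

context folner_net
begin

abbreviation density_at :: "'g set \<Rightarrow> 'd \<Rightarrow> real" where
  "density_at A n \<equiv> real (card (A \<inter> F n)) / real (card (F n))"

definition null :: "'g set \<Rightarrow> bool" where
  "null A \<longleftrightarrow> (density_at A \<longlongrightarrow> 0) (tails D r)"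

text \<open>By directedness and transitivity two tails contain a third, so the tails form a base of
  the filter.\<close>

lemma eventually_tails:
  "eventually P (tails D r) \<longleftrightarrow> (\<exists>m\<in>D. \<forall>n\<in>D. (m, n) \<in> r \<longrightarrow> P n)"
proof -
  have "D \<noteq> {}" "trans r" and dir: "\<And>m n. m \<in> D \<Longrightarrow> n \<in> D \<Longrightarrow> \<exists>k\<in>D. (m, k) \<in> r \<and> (n, k) \<in> r"
    using directed by (auto simp: directed_set_def preorder_on_def)
  have "eventually P (tails D r) \<longleftrightarrow> (\<exists>m\<in>D. eventually P (principal {n \<in> D. (m, n) \<in> r}))"
    unfolding tails_def
  proof (rule eventually_INF_base[OF \<open>D \<noteq> {}\<close>])
    fix a b assume "a \<in> D" "b \<in> D"
    then obtain k where "k \<in> D" "(a, k) \<in> r" "(b, k) \<in> r"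
      using dir by blast
    then show "\<exists>k\<in>D. principal {n \<in> D. (k, n) \<in> r}
        \<le> inf (principal {n \<in> D. (a, n) \<in> r}) (principal {n \<in> D. (b, n) \<in> r})"
      using \<open>trans r\<close> by (intro bexI[of _ k]) (auto dest: transD)
  qed
  then show ?thesis
    by (auto simp: eventually_principal)
qed

lemma eventually_tails_in: "eventually (\<lambda>n. n \<in> D) (tails D r)"
  using directed by (auto simp: eventually_tails directed_set_def)

lemma tails_refl: "m \<in> D \<Longrightarrow> (m, m) \<in> r"
  using directed by (auto simp: directed_set_def preorder_on_def refl_on_def)

lemma card_F_pos: "n \<in> D \<Longrightarrow> card (F n) > 0"
  using F_finite F_nonempty by (simp add: card_gt_0_iff)

lemma density_at_le_1:
  assumes "n \<in> D"
  shows "density_at A n \<le> 1"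
  using card_F_pos[OF assms] card_mono[OF F_finite[OF assms], of "A \<inter> F n"] by simp

lemma density_at_compl:
  assumes "n \<in> D"
  shows "density_at (carrier G - A) n = 1 - density_at A n"
proof -
  have "(carrier G - A) \<inter> F n = F n - A \<inter> F n"
    using F_subset[OF assms] by auto
  then have "card ((carrier G - A) \<inter> F n) = card (F n) - card (A \<inter> F n)"
    using F_finite[OF assms] by (simp add: card_Diff_subset)
  then show ?thesis
    using card_F_pos[OF assms] card_mono[OF F_finite[OF assms], of "A \<inter> F n"]
    by (simp add: diff_divide_distrib)
qed

lemma null_iff:
  "null A \<longleftrightarrow> (\<forall>\<epsilon>>0. \<forall>\<^sub>F n in tails D r. density_at A n < \<epsilon>)"
  unfolding null_def tendsto_iff by simp

lemma null_tendsto_bound: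
  assumes "(f \<longlongrightarrow> 0) (tails D r)" "\<And>n. n \<in> D \<Longrightarrow> density_at A n \<le> f n"
  shows "null A"
  unfolding null_def
  by (rule tendsto_sandwich[OF _ _ tendsto_const assms(1)])
    (use assms(2) in \<open>auto intro: eventually_mono[OF eventually_tails_in]\<close>)

lemma null_subset: "null B \<Longrightarrow> A \<subseteq> B \<Longrightarrow> null A"
  using F_finite
  by (auto simp: null_def
      intro!: null_tendsto_bound[of "density_at B", unfolded null_def] divide_right_mono card_mono)

lemma null_Un:
  assumes "null A" "null B"
  shows "null (A \<union> B)"
proof (rule null_tendsto_bound)
  show "((\<lambda>n. density_at A n + density_at B n) \<longlongrightarrow> 0) (tails D r)"
    using tendsto_add[of "density_at A" 0 "tails D r" "density_at B" 0] assms by (simp add: null_def)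
  show "density_at (A \<union> B) n \<le> density_at A n + density_at B n" for n
    using card_Un_le[of "A \<inter> F n" "B \<inter> F n"]
    by (auto simp: Int_Un_distrib2 add_divide_distrib[symmetric] intro!: divide_right_mono)
qed

lemma null_empty: "null {}"
  by (simp add: null_def)

lemma null_UN: "finite I \<Longrightarrow> (\<And>i. i \<in> I \<Longrightarrow> null (A i)) \<Longrightarrow> null (\<Union>i\<in>I. A i)"
  by (induction I rule: finite_induct) (auto simp: null_empty null_Un)

text \<open>Left multiplication by \<open>h\<close> injects the translated set within
  \<open>F n\<close> into \<open>A \<inter> (h <# F n)\<close>. This exceeds
  \<open>A \<inter> F n\<close> by at most the symmetric difference, whose proportion vanishes by
  the Folner condition.\<close>

lemma null_translate:
  assumes "null A" and h: "h \<in> carrier G"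
  shows "null {g \<in> carrier G. h \<otimes> g \<in> A}"
proof (rule null_tendsto_bound)
  show "((\<lambda>n. density_at A n + real (card (sym_diff (h <# F n) (F n))) / real (card (F n))) \<longlongrightarrow> 0) (tails D r)"
    using tendsto_add[OF assms(1)[unfolded null_def] folner[OF h]] by simp
  fix n assume n: "n \<in> D"
  have fin: "finite (h <# F n)"
    using F_finite[OF n] by (simp add: l_coset_def)
  have "card ({g \<in> carrier G. h \<otimes> g \<in> A} \<inter> F n) \<le> card (A \<inter> (h <# F n))"
  proof (rule card_inj_on_le[where f = "\<lambda>g. h \<otimes> g"])
    show "inj_on (\<lambda>g. h \<otimes> g) ({g \<in> carrier G. h \<otimes> g \<in> A} \<inter> F n)"
      using h by (auto simp: inj_on_def)
  qed (use fin in \<open>auto simp: l_coset_def\<close>)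
  also have "\<dots> \<le> card ((A \<inter> F n) \<union> sym_diff (h <# F n) (F n))"
    by (rule card_mono) (use fin F_finite[OF n] in auto)
  also have "\<dots> \<le> card (A \<inter> F n) + card (sym_diff (h <# F n) (F n))"
    by (rule card_Un_le)
  finally show "density_at {g \<in> carrier G. h \<otimes> g \<in> A} n
      \<le> density_at A n + real (card (sym_diff (h <# F n) (F n))) / real (card (F n))"
    by (simp add: add_divide_distrib[symmetric] divide_right_mono flip: of_nat_add)
qed

text \<open>Take \<open>N\<close> group elements. If each of them moves less than a fraction
  \<open>1/N\<close> of a set \<open>F n\<close> with fewer than \<open>N\<close> elements, then it
  moves none. So \<open>F n\<close> contains the \<open>N\<close> distinct products of these
  elements with one \<open>f\<close> in \<open>F n\<close>, a contradiction.\<close>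

lemma eventually_card_F_ge:
  assumes "infinite (carrier G)"
  shows "\<forall>\<^sub>F n in tails D r. N \<le> card (F n)"
proof (cases "N = 0")
  case False
  obtain S where S: "finite S" "card S = N" "S \<subseteq> carrier G"
    using infinite_arbitrarily_large[OF assms] by blast
  have "\<forall>\<^sub>F n in tails D r. \<forall>g\<in>S. real (card (sym_diff (g <# F n) (F n))) / real (card (F n)) < 1 / real N"
    by (intro eventually_ball_finite S ballI order_tendstoD(2)[OF folner]) (use S False in auto)
  with eventually_tails_in show ?thesis
  proof eventually_elim
    case (elim n)
    show ?case
    proof (rule ccontr)
      assume less: "\<not> N \<le> card (F n)"
      obtain f where f: "f \<in> F n"
        using F_nonempty[OF elim(1)] by blast
      text \<open>A symmetric difference with fewer than \<open>card (F n) / N < 1\<close> elements is empty.\<close>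
      have "g \<otimes> f \<in> F n" if "g \<in> S" for g
      proof -
        have "real (card (sym_diff (g <# F n) (F n))) < real (card (F n)) / real N"
          using elim(2) that card_F_pos[OF elim(1)] by (simp add: field_simps)
        also have "\<dots> < 1"
          using less by simp
        finally have "sym_diff (g <# F n) (F n) = {}"
          using F_finite[OF elim(1)] by (simp add: l_coset_def)
        then show ?thesis
          using f by (auto simp: l_coset_def)
      qed
      \<comment> \<open>Right cancellation makes \<open>g \<mapsto> g \<otimes> f\<close> injective
        on \<open>S\<close>.\<close>
      then have "card S \<le> card (F n)"
        using f F_subset[OF elim(1)] S(3) F_finite[OF elim(1)]
        by (intro card_inj_on_le[where f = "\<lambda>g. g \<otimes> f"]) (auto simp: inj_on_def subset_iff)
      then show False
        using less S by simp
    qed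
  qed
qed simp

lemma null_finite:
  assumes "infinite (carrier G)" "finite K"
  shows "null K"
proof (rule null_tendsto_bound)
  have "filterlim (\<lambda>n. real (card (F n))) at_top (tails D r)"
    unfolding filterlim_at_top
  proof
    fix Z :: real
    show "\<forall>\<^sub>F n in tails D r. Z \<le> real (card (F n))"
      using eventually_card_F_ge[OF assms(1), of "nat \<lceil>Z\<rceil>"] by eventually_elim linarith
  qed
  then show "((\<lambda>n. real (card K) / real (card (F n))) \<longlongrightarrow> 0) (tails D r)"
    by (intro tendsto_divide_0[OF tendsto_const] filterlim_at_top_imp_at_infinity)
  show "density_at K n \<le> real (card K) / real (card (F n))" for n
    using assms(2) by (auto intro!: divide_right_mono card_mono)
qed

text \<open>Lower density 1 puts the proportion eventually above every number below 1. Conversely,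
  if the complement is null, every \<alpha> < 1 belongs to the set defining the lower density, and
  both suprema are squeezed to 1.\<close>

lemma has_density_1_iff: "has_density D r F A 1 \<longleftrightarrow> null (carrier G - A)"
proof -
  let ?L = "{\<alpha>. \<exists>m\<in>D. \<forall>n\<in>D. (m, n) \<in> r \<longrightarrow> density_at A n \<ge> \<alpha>}"
  let ?U = "{\<alpha>. \<forall>m\<in>D. \<exists>n\<in>D. (m, n) \<in> r \<and> density_at A n \<ge> \<alpha>}"
  obtain m0 where m0: "m0 \<in> D"
    using directed by (auto simp: directed_set_def)
  have U1: "\<alpha> \<le> 1" if "\<alpha> \<in> ?U" for \<alpha>
  proof -
    obtain n where "n \<in> D" "\<alpha> \<le> density_at A n"
      using \<open>\<alpha> \<in> ?U\<close> m0 by blast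
    then show ?thesis
      using density_at_le_1[of n A] by linarith
  qed
  have L1: "\<alpha> \<le> 1" if "\<alpha> \<in> ?L" for \<alpha>
  proof -
    obtain m where "m \<in> D" "\<alpha> \<le> density_at A m"
      using \<open>\<alpha> \<in> ?L\<close> tails_refl by blast
    then show ?thesis
      using density_at_le_1[of m A] by linarith
  qed
  \<comment> \<open>With the bound 1 above, this makes both real suprema genuine: they are taken
    over nonempty bounded sets.\<close>
  have L0: "0 \<in> ?L" and U0: "0 \<in> ?U"
    using m0 tails_refl by auto
  \<comment> \<open>A common successor of the two indices lies in the good tail and beyond the
    prescribed index.\<close>
  have LU: "?L \<subseteq> ?U"
  proof safe
    fix \<alpha> m m' assume "m \<in> D" "\<forall>n\<in>D. (m, n) \<in> r \<longrightarrow> density_at A n \<ge> \<alpha>" "m' \<in> D"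
    moreover obtain k where "k \<in> D" "(m, k) \<in> r" "(m', k) \<in> r"
      using directed \<open>m \<in> D\<close> \<open>m' \<in> D\<close> by (auto simp: directed_set_def)
    ultimately show "\<exists>n\<in>D. (m', n) \<in> r \<and> density_at A n \<ge> \<alpha>"
      by blast
  qed
  have L: "\<alpha> \<in> ?L \<longleftrightarrow> (\<forall>\<^sub>F n in tails D r. density_at A n \<ge> \<alpha>)" for \<alpha>
    by (simp add: eventually_tails)
  have compl: "(\<forall>\<^sub>F n in tails D r. P (density_at (carrier G - A) n)) \<longleftrightarrow> (\<forall>\<^sub>F n in tails D r. P (1 - density_at A n))"
    for P :: "real \<Rightarrow> bool"
    by (rule eventually_cong[OF eventually_tails_in]) (simp add: density_at_compl)
  show ?thesis
  proof
    assume "has_density D r F A 1"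
    then have Sup: "Sup ?L = 1"
      by (simp add: has_density_def lower_density_def)
    show "null (carrier G - A)"
      unfolding null_iff
    proof (intro allI impI)
      fix \<epsilon> :: real assume "\<epsilon> > 0"
      then obtain \<alpha> where "\<alpha> \<in> ?L" "1 - \<epsilon> < \<alpha>"
        using less_cSupD[of ?L "1 - \<epsilon>"] Sup L0 by (metis (lifting) empty_iff diff_less_eq less_add_same_cancel1)
      then have "\<forall>\<^sub>F n in tails D r. 1 - density_at A n < \<epsilon>"
        unfolding L by (auto elim: eventually_mono)
      then show "\<forall>\<^sub>F n in tails D r. density_at (carrier G - A) n < \<epsilon>"
        using compl[of "\<lambda>t. t < \<epsilon>"] by simp
    qed
  next
    assume null: "null (carrier G - A)"
    have mem: "\<alpha> \<in> ?L" if "\<alpha> < 1" for \<alpha>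
    proof -
      have "\<forall>\<^sub>F n in tails D r. 1 - density_at A n < 1 - \<alpha>"
        using null that compl[of "\<lambda>t. t < 1 - \<alpha>"] unfolding null_iff by simp
      then show ?thesis
        unfolding L by (auto elim: eventually_mono)
    qed
    have bdd: "bdd_above ?L" "bdd_above ?U"
      by (rule bdd_aboveI[of _ 1], rule L1, assumption) (rule bdd_aboveI[of _ 1], rule U1, assumption)
    have "1 \<le> Sup ?L"
      by (rule dense_le) (rule cSup_upper[OF mem bdd(1)])
    moreover have "Sup ?L \<le> Sup ?U"
      by (rule cSup_subset_mono[OF _ bdd(2) LU]) (use L0 in blast)
    moreover have "Sup ?U \<le> 1"
      by (rule cSup_least) (use U0 in blast, rule U1)
    ultimately show "has_density D r F A 1"
      by (simp add: has_density_def lower_density_def upper_density_def)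
  qed
qed

end

section \<open>The minimal center of attraction\<close>

locale folner_system = G_system G X act + folner_net G D r F
  for G :: "('g, 'b) monoid_scheme" (structure)
    and X :: "'a::metric_space set"
    and act :: "'g \<Rightarrow> 'a \<Rightarrow> 'a"
    and D :: "'d set"
    and r :: "'d rel"
    and F :: "'d \<Rightarrow> 'g set"
begin

abbreviation visits :: "'a \<Rightarrow> 'a set \<Rightarrow> 'g set" where
  "visits x U \<equiv> {g \<in> carrier G. act g x \<in> U}"

definition center :: "'a \<Rightarrow> 'a set" where
  "center x = {z \<in> X. \<forall>\<epsilon>>0. \<not> null (visits x (ball z \<epsilon>))}"

lemma center_subset: "center x \<subseteq> X"
  by (auto simp: center_def)

lemma not_null_visits_center:
  assumes "z \<in> center x" "\<epsilon> > 0"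
  shows "\<not> null (visits x (ball z \<epsilon>))"
  using assms unfolding center_def by blast

text \<open>Every ball about a limit point contains a smaller ball about a point of the center, and
  subsets of null sets are null.\<close>

lemma closed_center: "closed (center x)"
proof -
  have "closed X"
    using compact_space by (rule compact_imp_closed)
  show ?thesis
    unfolding closed_sequential_limits
  proof safe
    fix f z assume f: "\<forall>n. f n \<in> center x" and lim: "f \<longlonglongrightarrow> z"
    have "z \<in> X"
      using \<open>closed X\<close> f lim by (meson center_subset closed_sequentially subsetD)
    moreover have "\<not> null (visits x (ball z \<epsilon>))" if "\<epsilon> > 0" for \<epsilon>
    proof
      assume null: "null (visits x (ball z \<epsilon>))"
      obtain n where "dist (f n) z < \<epsilon>/2"
        using lim[unfolded lim_sequentially, rule_format, of "\<epsilon>/2"] \<open>\<epsilon> > 0\<close> by auto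
      then have "ball (f n) (\<epsilon>/2) \<subseteq> ball z \<epsilon>"
        using dist_triangle_half_r[of "f n" z \<epsilon>] by (auto simp: dist_commute)
      then have "null (visits x (ball (f n) (\<epsilon>/2)))"
        by (intro null_subset[OF null]) auto
      then show False
        using f not_null_visits_center[of "f n" x "\<epsilon>/2"] \<open>\<epsilon> > 0\<close> by simp
    qed
    ultimately show "z \<in> center x"
      by (auto simp: center_def)
  qed
qed

lemma center_of_attraction_iff:
  assumes "x \<in> X"
  shows "center_of_attraction G X act D r F x C \<longleftrightarrow>
    C \<subseteq> X \<and> closed C \<and> (\<forall>\<epsilon>>0. null (visits x (- (\<Union>c\<in>C. ball c \<epsilon>))))"
proof -
  have "closedin (top_of_set X) C \<longleftrightarrow> C \<subseteq> X \<and> closed C"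
    using compact_imp_closed[OF compact_space] closedin_closed_eq by blast
  moreover have "carrier G - visits x U = visits x (- U)" for U
    by auto
  ultimately show ?thesis
    by (simp only: center_of_attraction_def has_density_1_iff conj_assoc)
qed

text \<open>The part of \<open>X\<close> off the neighborhood is compact and each of its points has
  a ball with null visits. Finitely many such balls cover it, and a finite union of null sets is
  null.\<close>

lemma center_attracts:
  assumes x: "x \<in> X"
  shows "center_of_attraction G X act D r F x (center x)"
  unfolding center_of_attraction_iff[OF x]
proof (intro conjI center_subset closed_center allI impI)
  fix \<epsilon> :: real assume "\<epsilon> > 0"
  define K where "K = X - (\<Union>c\<in>center x. ball c \<epsilon>)"
  have "compact K"
    unfolding K_def by (intro compact_diff compact_space open_UN) auto
  have "\<exists>\<delta>>0. null (visits x (ball z \<delta>))" if "z \<in> K" for z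
  proof -
    have "z \<notin> center x"
      using that \<open>\<epsilon> > 0\<close> by (force simp: K_def)
    then show ?thesis
      using that by (auto simp: center_def K_def)
  qed
  then obtain \<delta> where \<delta>: "\<And>z. z \<in> K \<Longrightarrow> \<delta> z > 0 \<and> null (visits x (ball z (\<delta> z)))"
    by metis
  obtain I where I: "I \<subseteq> K" "finite I" "K \<subseteq> (\<Union>z\<in>I. ball z (\<delta> z))"
    by (rule compactE_image[OF \<open>compact K\<close>, of K "\<lambda>z. ball z (\<delta> z)"]) (use \<delta> in force)+
  have "null (\<Union>z\<in>I. visits x (ball z (\<delta> z)))"
    using I \<delta> by (intro null_UN) auto
  moreover have "visits x (- (\<Union>c\<in>center x. ball c \<epsilon>)) \<subseteq> (\<Union>z\<in>I. visits x (ball z (\<delta> z)))"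
  proof
    fix g assume g: "g \<in> visits x (- (\<Union>c\<in>center x. ball c \<epsilon>))"
    then have "act g x \<in> K"
      using act_in[OF _ x] by (auto simp: K_def)
    then show "g \<in> (\<Union>z\<in>I. visits x (ball z (\<delta> z)))"
      using I(3) g by blast
  qed
  ultimately show "null (visits x (- (\<Union>c\<in>center x. ball c \<epsilon>)))"
    by (rule null_subset)
qed

text \<open>A point of the center outside the closed set \<open>C\<close> has a ball that misses a
  neighborhood of \<open>C\<close>. The visits to that ball would be null, contrary to the choice of
  the point.\<close>

lemma center_least:
  assumes x: "x \<in> X" and C: "center_of_attraction G X act D r F x C"
  shows "center x \<subseteq> C"
proof (rule ccontr)
  assume "\<not> center x \<subseteq> C"
  then obtain z where z: "z \<in> center x" "z \<notin> C"
    by blast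
  have "closed C" and null: "\<And>\<epsilon>. \<epsilon> > 0 \<Longrightarrow> null (visits x (- (\<Union>c\<in>C. ball c \<epsilon>)))"
    using C by (auto simp: center_of_attraction_iff[OF x])
  then obtain e where e: "e > 0" "ball z e \<inter> C = {}"
    using z(2) open_contains_ball[of "- C"] unfolding closed_def disjoint_eq_subset_Compl by blast
  \<comment> \<open>Half the radius goes to the ball about \<open>z\<close> and half to the
    neighborhood of \<open>C\<close>, so a common point would put some \<open>c\<close> within
    \<open>e\<close> of \<open>z\<close>.\<close>
  have "ball z (e/2) \<subseteq> - (\<Union>c\<in>C. ball c (e/2))"
  proof
    fix w assume w: "w \<in> ball z (e/2)"
    have False if "c \<in> C" "w \<in> ball c (e/2)" for c
    proof -
      have "dist z c < e"
        using w that dist_triangle_half_l[of z w e c] by simp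
      then show False
        using e that by auto
    qed
    then show "w \<in> - (\<Union>c\<in>C. ball c (e/2))"
      by blast
  qed
  then have "null (visits x (ball z (e/2)))"
    using e(1) by (intro null_subset[OF null[of "e/2"]]) auto
  then show False
    using not_null_visits_center[OF z(1), of "e/2"] e(1) by simp
qed

text \<open>\<open>center x\<close> is the least center of attraction, which makes it the only
  minimal one.\<close>

lemma minimal_center_eq:
  assumes x: "x \<in> X"
  shows "minimal_center G X act D r F x = center x"
  unfolding minimal_center_def
proof (rule the_equality)
  show "center_of_attraction G X act D r F x (center x) \<and>
      (\<forall>C'. C' \<subset> center x \<longrightarrow> \<not> center_of_attraction G X act D r F x C')"
    using center_attracts[OF x] center_least[OF x] by blast
next
  fix C assume "center_of_attraction G X act D r F x C \<and>
      (\<forall>C'. C' \<subset> C \<longrightarrow> \<not> center_of_attraction G X act D r F x C')"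
  then show "C = center x"
    using center_attracts[OF x] center_least[OF x] by blast
qed

text \<open>The empty set is null, so every ball about a point of the center is visited at least
  once.\<close>

lemma center_orbit_closure: "center x \<subseteq> closure ((\<lambda>g. act g x) ` carrier G)"
proof
  fix z assume z: "z \<in> center x"
  show "z \<in> closure ((\<lambda>g. act g x) ` carrier G)"
    unfolding closure_approachable
  proof (intro allI impI)
    fix e :: real assume "e > 0"
    then have "\<not> null (visits x (ball z e))"
      by (rule not_null_visits_center[OF z])
    then have "visits x (ball z e) \<noteq> {}"
      using null_empty by metis
    then show "\<exists>y\<in>(\<lambda>g. act g x) ` carrier G. dist y z < e"
      by (auto simp: dist_commute)
  qed
qed

lemma center_invariant:
  assumes x: "x \<in> X"
  shows "G_invariant G act (center x)"
  unfolding G_invariant_def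
proof safe
  fix h z assume h: "h \<in> carrier G" and z: "z \<in> center x"
  have zX: "z \<in> X"
    using z center_subset by blast
  have "\<not> null (visits x (ball (act h z) \<epsilon>))" if "\<epsilon> > 0" for \<epsilon>
  proof
    assume null: "null (visits x (ball (act h z) \<epsilon>))"
    obtain \<delta> where \<delta>: "\<delta> > 0" "\<And>w. w \<in> X \<Longrightarrow> dist w z < \<delta> \<Longrightarrow> dist (act h w) (act h z) < \<epsilon>"
      using act_continuous[OF h, unfolded continuous_on_iff, rule_format, OF zX \<open>\<epsilon> > 0\<close>] by blast
    \<comment> \<open>By the choice of \<delta>, a visit near \<open>z\<close> at time
      \<open>g\<close> becomes a visit near \<open>act h z\<close> at time
      \<open>h \<otimes> g\<close>.\<close>
    have "visits x (ball z \<delta>) \<subseteq> {g \<in> carrier G. h \<otimes> g \<in> visits x (ball (act h z) \<epsilon>)}"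
      using \<delta>(2)[OF act_in[OF _ x]] h x by (auto simp: act_mult dist_commute)
    then have "null (visits x (ball z \<delta>))"
      by (rule null_subset[OF null_translate[OF null h]])
    then show False
      using not_null_visits_center[OF z \<delta>(1)] by simp
  qed
  then show "act h z \<in> center x"
    using act_in[OF h zX] by (auto simp: center_def)
qed

text \<open>Off a finite set of times the two orbits are \<epsilon>/2-close, so an
  \<epsilon>/2-visit of \<open>x\<close> is an \<epsilon>-visit of \<open>y\<close>. The finite
  exception is null because the group is infinite.\<close>

lemma asymptotic_center_subset:
  assumes "asymptotic_pair G act x y"
  shows "center x \<subseteq> center y"
proof
  fix z assume z: "z \<in> center x"
  have "\<not> null (visits y (ball z \<epsilon>))" if \<epsilon>: "\<epsilon> > 0" for \<epsilon>
  proof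
    assume null: "null (visits y (ball z \<epsilon>))"
    obtain n :: nat where n: "n \<noteq> 0" "inverse (real n) < \<epsilon>/2"
      using real_arch_inverse[of "\<epsilon>/2"] \<epsilon> by auto
    then obtain K where K: "finite K" "\<And>g. g \<in> carrier G - K \<Longrightarrow> dist (act g x) (act g y) < 1 / real n"
      using assms[unfolded asymptotic_pair_def, rule_format, of n] by auto
    have "visits x (ball z (\<epsilon>/2)) \<subseteq> visits y (ball z \<epsilon>) \<union> K"
    proof
      fix g assume g: "g \<in> visits x (ball z (\<epsilon>/2))"
      have "dist z (act g y) < \<epsilon>" if "g \<notin> K"
      proof -
        have "dist (act g x) (act g y) < \<epsilon>/2"
          using K(2)[of g] g that n(2) by (simp add: inverse_eq_divide)
        moreover have "dist z (act g x) < \<epsilon>/2"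
          using g by simp
        ultimately show ?thesis
          using dist_triangle[of z "act g y" "act g x"] by linarith
      qed
      then show "g \<in> visits y (ball z \<epsilon>) \<union> K"
        using g by auto
    qed
    then have "null (visits x (ball z (\<epsilon>/2)))"
      by (rule null_subset[OF null_Un[OF null null_finite[OF infinite_carrier K(1)]]])
    then show False
      using not_null_visits_center[OF z, of "\<epsilon>/2"] \<epsilon> by simp
  qed
  then show "z \<in> center y"
    using z by (auto simp: center_def)
qed

lemma asymptotic_center_eq:
  assumes "asymptotic_pair G act x y"
  shows "center x = center y"
proof -
  have "asymptotic_pair G act y x"
    using assms by (simp add: asymptotic_pair_def dist_commute)
  then show ?thesis
    using assms asymptotic_center_subset by blast
qed

end

section \<open>A proximal point of \<Lambda> that cannot be asymptotic to \<open>x\<close>\<close>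

theorem theorem3p2:
  fixes G :: "('g, 'b) monoid_scheme"
    and X :: "'a::metric_space set"
    and act :: "'g \<Rightarrow> 'a \<Rightarrow> 'a"
    and D :: "'d set"
    and r :: "'d rel"
    and F :: "'d \<Rightarrow> 'g set"
    and x :: 'a
  assumes "G_system G X act"
    and "folner_net G D r F"
    and "x \<in> X"
    and "\<not> S_generic G X act D r F (minimal_center G X act D r F x)"
  shows "\<forall>\<Lambda>. \<Lambda> \<noteq> {} \<and> closedin (top_of_set X) \<Lambda> \<and> G_invariant G act \<Lambda> \<and>
           \<Lambda> \<subseteq> minimal_center G X act D r F x \<longrightarrow>
           (\<exists>y \<in> \<Lambda>. Li_Yorke_pair G act x y)"
proof (intro allI impI, elim conjE)
  interpret folner_system G X act D r F
    using assms(1,2) by (simp add: folner_system_def)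
  fix \<Lambda> assume \<Lambda>: "\<Lambda> \<noteq> {}" "closedin (top_of_set X) \<Lambda>" "G_invariant G act \<Lambda>"
    "\<Lambda> \<subseteq> minimal_center G X act D r F x"
  have \<Lambda>_center: "\<Lambda> \<subseteq> center x"
    using \<Lambda>(4) minimal_center_eq[OF assms(3)] by simp
  have "closed \<Lambda>" "\<Lambda> \<subseteq> X"
    using \<Lambda>(2) compact_imp_closed[OF compact_space] closedin_closed_eq by blast+
  then obtain y where y: "y \<in> \<Lambda>" "proximal_pair G act x y"
    using proximal_point_exists[OF assms(3) \<Lambda>(1)] \<Lambda>(3) \<Lambda>_center center_orbit_closure by blast
  have "\<not> asymptotic_pair G act x y"
  proof
    assume "asymptotic_pair G act x y"
    then have "center x = minimal_center G X act D r F y"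
      using asymptotic_center_eq minimal_center_eq y(1) \<open>\<Lambda> \<subseteq> X\<close> by blast
    \<comment> \<open>Since \<open>y\<close> lies in \<Lambda>, it lies in \<open>center x\<close>,
      which is also its own center; this is the witness that S-genericity asks for.\<close>
    then have "S_generic G X act D r F (center x)"
      using y(1) \<Lambda>_center center_subset center_invariant[OF assms(3)]
      by (auto simp: S_generic_def)
    then show False
      using assms(3,4) minimal_center_eq by simp
  qed
  then show "\<exists>y\<in>\<Lambda>. Li_Yorke_pair G act x y"
    using y by (auto simp: Li_Yorke_pair_def)
qed

end
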